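(* Let $X,Y,a,A,b,u,\mathcal{S}_X$ be as in the context, and assume that the norms satisfy $\|Av\|_{Y'}=\|v\|_X$ for all $v\in X$. Let $\delta>0$ and $\eta\ge 1$ satisfy $\delta(1+\eta)<1$. Let $\Lambda^\delta:Y\to Y$ be a (not necessarily linear) mapping such that $$\|\Lambda^\delta(y)-y\|_Y\le \delta\|y\|_Y\quad\text{for all } y\in \mathcal{D}_Y=\{R_Y^{-1}(Av-b)\,:\,v\in\mathcal{S}_X\}.$$ For each $v\in X$ let $\Pi^\eta_{\mathcal{S}_X}(v)\subset\mathcal{S}_X$ be a nonempty set of quasi-optimal approximations of $v$, i.e. such that $$\|v-w\|_X\le \eta\,\min_{z\in\mathcal{S}_X}\|v-z\|_X\quad\text{for all } w\in \Pi^\eta_{\mathcal{S}_X}(v).$$ Let $u^0=0$ and let $\{u^k\}_{k\ge0}\subset\mathcal{S}_X$, $\{y^k\}_{k\ge 0}\subset Y$ be any sequences satisfying, for all $k\ge0$, $$y^k=\Lambda^\delta\big(R_Y^{-1}(Au^k-b)\big),\qquad u^{k+1}\in\Pi^\eta_{\mathcal{S}_X}\big(u^k-R_X^{-1}A^*y^k\big).$$ Then, for all $k\ge 1$, $$\|u^k-u\|_X\le \big((1+\eta)\delta\big)^k\|u^0-u\|_X+\frac{\eta}{1-\delta(1+\eta)}\,\|u-\Pi_{\mathcal{S}_X}(u)\|_X.$$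
   Context: $X$ and $Y$ are real Hilbert spaces (in the paper, Hilbert tensor spaces, i.e. completions of algebraic tensor products of $d$ Hilbert spaces; $d=1$ gives an arbitrary Hilbert space). For a Hilbert space $H$ with dual $H'$, $R_H:H\to H'$ denotes the Riesz isomorphism, $\langle R_Hv,w\rangle_{H',H}=\langle v,w\rangle_H$, and $H'$ has the dual norm. $a:X\times Y\to\mathbb{R}$ is a continuous weakly coercive bilinear form: $\sup_{v\in X}\sup_{w\in Y}\frac{a(v,w)}{\|v\|_X\|w\|_Y}=\beta<\infty$, $\inf_{v\in X}\sup_{w\in Y}\frac{a(v,w)}{\|v\|_X\|w\|_Y}=\alpha>0$, and $\sup_{v\in X}\frac{a(v,w)}{\|v\|_X}>0$ for every $w\ne0$ in $Y$ (suprema and infima over nonzero vectors). $A:X\to Y'$ is the operator with $\langle Av,w\rangle_{Y',Y}=a(v,w)$; it is an isomorphism. $A^*:Y\to X'$ is its adjoint, $\langle Av,w\rangle_{Y',Y}=\langle v,A^*w\rangle_{X,X'}$. Given $b\in Y'$, $u\in X$ is the unique solution of $Au=b$. $\mathcal{S}_X\subset X$ is a nonempty weakly closed subset with $\gamma\mathcal{S}_X\subset\mathcal{S}_X$ for all $\gamma\in\mathbb{R}$ (so $0\in\mathcal{S}_X$). For $v\in X$, $\Pi_{\mathcal{S}_X}(v)=\arg\min_{z\in\mathcal{S}_X}\|v-z\|_X$ is the (nonempty) set of best approximations, and $\|v-\Pi_{\mathcal{S}_X}(v)\|_X$ denotes the common value $\min_{z\in\mathcal{S}_X}\|v-z\|_X$.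 *)

theory Defs
  imports "HOL-Analysis.Analysis"
begin

(* The topological dual of H is 'h \<Rightarrow>\<^sub>L real with its operator norm. On a complete space
   this map is bijective (Riesz representation), so that inv riesz is its genuine inverse. *)
definition riesz :: "'h::real_inner \<Rightarrow> 'h \<Rightarrow>\<^sub>L real" where
  "riesz v = blinfun_inner_right v"

lemma riesz_apply [simp]: "blinfun_apply (riesz v) w = v \<bullet> w"
  by (simp add: riesz_def)

(* Suprema and infima are taken in the extended reals, so that finiteness of the first
   supremum really says that the form is bounded (real-valued SUP/INF would be
   unspecified on unbounded families). *)
definition weakly_coercive_form ::
  "('x::real_normed_vector \<Rightarrow> 'y::real_normed_vector \<Rightarrow> real) \<Rightarrow> bool" where
  "weakly_coercive_form a \<longleftrightarrow>
     bilinear a \<and>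
     (SUP v\<in>-{0}. SUP w\<in>-{0}. ereal (a v w / (norm v * norm w))) < \<infinity> \<and>
     (INF v\<in>-{0}. SUP w\<in>-{0}. ereal (a v w / (norm v * norm w))) > 0 \<and>
     (\<forall>w. w \<noteq> 0 \<longrightarrow> (SUP v\<in>-{0}. ereal (a v w / norm v)) > 0)"

(* The coarsest topology making every continuous linear functional continuous. *)
definition weak_topology :: "'a::real_normed_vector topology" where
  "weak_topology =
     topology_generated_by {blinfun_apply f -` U |(f :: 'a \<Rightarrow>\<^sub>L real) U. open U}"

definition best_approx :: "'a::real_normed_vector set \<Rightarrow> 'a \<Rightarrow> 'a set" where
  "best_approx S v = {z. is_arg_min (\<lambda>z. norm (v - z)) (\<lambda>z. z \<in> S) z}"

(* The common value of norm (v - z) over all best approximations z, i.e. the minimum of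
   norm (v - z) over S; meaningful whenever best_approx S v is nonempty. *)
definition best_error :: "'a::real_normed_vector set \<Rightarrow> 'a \<Rightarrow> real" where
  "best_error S v = the_elem ((\<lambda>z. norm (v - z)) ` best_approx S v)"

lemma best_error_eq:
  assumes "z \<in> best_approx S v"
  shows "best_error S v = norm (v - z)"
proof -
  have "norm (v - y) = norm (v - z)" if "y \<in> best_approx S v" for y
    using assms that unfolding best_approx_def is_arg_min_def mem_Collect_eq
    by (meson linorder_neqE)
  then have "(\<lambda>z. norm (v - z)) ` best_approx S v = {norm (v - z)}"
    using assms by blast
  then show ?thesis
    by (simp add: best_error_def)
qed

end

theory Submission
  imports Defs
begin

text \<open>
  Write \<open>T = R\<^sub>Y\<inverse> A\<close> and \<open>T' = R\<^sub>X\<inverse> A\<^sup>*\<close>. Since \<open>A\<close> is isometric, \<open>T\<close> preserves inner products, so its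
  Hilbert adjoint \<open>T'\<close> satisfies \<open>T' T = id\<close> and does not increase norms. With the exact residual
  \<open>T (u\<^sub>k - u)\<close> in place of \<open>y\<^sub>k\<close>, the point \<open>v\<^sub>k = u\<^sub>k - T' y\<^sub>k\<close> would therefore be \<open>u\<close> itself, and
  the relative error \<open>\<delta>\<close> of \<open>\<Lambda>\<close> leaves \<open>\<parallel>v\<^sub>k - u\<parallel> \<le> \<delta> \<parallel>u\<^sub>k - u\<parallel>\<close>. The distance to \<open>S\<close> is
  1-Lipschitz, hence quasi-optimality of \<open>u\<^sub>k\<^sub>+\<^sub>1\<close> for \<open>v\<^sub>k\<close> yields
  \<open>\<parallel>u\<^sub>k\<^sub>+\<^sub>1 - u\<parallel> \<le> (1 + \<eta>) \<delta> \<parallel>u\<^sub>k - u\<parallel> + \<eta> dist(u, S)\<close>, and iterating this affine recursion gives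
  the bound.

  Two facts of Hilbert space theory carry the argument: the Riesz representation theorem
  (\<open>surj_riesz\<close>), which makes \<open>inv riesz\<close> a genuine inverse, and the existence of best approximations
  in a weakly closed set (\<open>best_approx_nonempty\<close>), without which \<open>best_error\<close> would not be the
  distance to the set. The latter is a compactness argument: a minimizing sequence is bounded, so by
  Tychonoff's theorem the functionals that it induces have a pointwise cluster point; this is again
  bounded and linear, and its Riesz representative is a best approximation.
\<close>

section \<open>Riesz representation\<close>

text \<open>
  The representative of \<open>f\<close> is the minimizer of \<open>J x = \<parallel>x\<parallel>\<^sup>2 - 2 f x\<close>. The parallelogram identity
  \<open>\<parallel>x - y\<parallel>\<^sup>2 = 2 J x + 2 J y - 4 J ((x + y) / 2)\<close> makes minimizing sequences Cauchy, and the first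
  variation of \<open>J\<close> at the minimizer is the representation formula.
\<close>
lemma riesz_representation:
  fixes f :: "'h::{real_inner, complete_space} \<Rightarrow> real"
  assumes "bounded_linear f"
  obtains x where "\<And>w. f w = x \<bullet> w"
proof -
  interpret f: bounded_linear f by fact
  define J where "J x = x \<bullet> x - 2 * f x" for x
  obtain M where M: "\<And>x. norm (f x) \<le> norm x * M"
    using f.bounded by blast
  have J_lower: "- (M\<^sup>2) \<le> J x" for x
  proof -
    have "f x \<le> norm x * M" using M[of x] by simp
    moreover have "0 \<le> (norm x - M)\<^sup>2" by simp
    ultimately show ?thesis
      by (simp add: J_def power2_diff flip: power2_norm_eq_inner)
  qed
  define m where "m = Inf (range J)"
  have bdd: "bdd_below (range J)"
    using J_lower by (intro bdd_belowI[of _ "- (M\<^sup>2)"]) auto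
  have m_le: "m \<le> J x" for x
    unfolding m_def by (intro cInf_lower bdd) auto
  have "\<exists>x. J x < m + inverse (real (Suc n))" for n
  proof -
    have "Inf (range J) < m + inverse (real (Suc n))"
      by (simp add: m_def)
    then show ?thesis
      using cInf_less_iff[OF _ bdd] by auto
  qed
  then obtain X where X: "\<And>n. J (X n) < m + inverse (real (Suc n))"
    by metis
  have par: "(norm (x - y))\<^sup>2 = 2 * J x + 2 * J y - 4 * J ((1/2) *\<^sub>R (x + y))" for x y
    unfolding J_def power2_norm_eq_inner
    by (simp add: f.scaleR f.add inner_diff inner_add algebra_simps inner_commute)
  have dist_X: "(norm (x - y))\<^sup>2 \<le> 4 * e"
    if "J x \<le> m + e" "J y \<le> m + e" for x y e
    using par[of x y] m_le[of "(1/2) *\<^sub>R (x + y)"] that by linarith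
  have "Cauchy X"
  proof (rule metric_CauchyI)
    fix e :: real assume "0 < e"
    then obtain N where N: "inverse (real (Suc N)) < e\<^sup>2 / 4"
      using reals_Archimedean[of "e\<^sup>2 / 4"] by auto
    have J_X: "J (X n) \<le> m + inverse (real (Suc N))" if "N \<le> n" for n
    proof -
      have "inverse (real (Suc n)) \<le> inverse (real (Suc N))"
        using that by (intro le_imp_inverse_le) auto
      then show ?thesis using X[of n] by linarith
    qed
    have "dist (X i) (X j) < e" if "N \<le> i" "N \<le> j" for i j
    proof -
      have "(norm (X i - X j))\<^sup>2 < e\<^sup>2"
        using dist_X[OF J_X[OF that(1)] J_X[OF that(2)]] N by linarith
      then show ?thesis
        using \<open>0 < e\<close> by (simp add: dist_norm power2_less_imp_less)
    qed
    then show "\<exists>N. \<forall>i\<ge>N. \<forall>j\<ge>N. dist (X i) (X j) < e" by blast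
  qed
  then obtain x where x: "X \<longlonglongrightarrow> x"
    using Cauchy_convergent convergent_def by blast
  have "(\<lambda>n. J (X n)) \<longlonglongrightarrow> J x"
    unfolding J_def by (intro tendsto_intros x f.tendsto)
  moreover have "(\<lambda>n. m + inverse (real (Suc n))) \<longlonglongrightarrow> m + 0"
    by (intro tendsto_intros LIMSEQ_inverse_real_of_nat)
  ultimately have "J x \<le> m + 0"
    by (rule LIMSEQ_le) (use X less_imp_le in blast)
  then have min: "J x \<le> J z" for z
    using m_le[of z] by simp
  have "f w = x \<bullet> w" for w
  proof (cases "w = 0")
    case False
    define c where "c = x \<bullet> w - f w"
    \<comment> \<open>The step \<open>- c / \<parallel>w\<parallel>\<^sup>2\<close> minimizes \<open>J\<close> on the line through \<open>x\<close> in direction \<open>w\<close>.\<close>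
    define t where "t = - c / (w \<bullet> w)"
    have "J (x + t *\<^sub>R w) = J x + t * t * (w \<bullet> w) + 2 * t * c"
      by (simp add: J_def c_def f.add f.scaleR inner_add inner_commute algebra_simps)
    also have "t * t * (w \<bullet> w) + 2 * t * c = - (c\<^sup>2 / (w \<bullet> w))"
      using False by (simp add: t_def field_simps power2_eq_square)
    then have "J x + t * t * (w \<bullet> w) + 2 * t * c = J x - c\<^sup>2 / (w \<bullet> w)"
      by simp
    finally have "c\<^sup>2 / (w \<bullet> w) \<le> 0"
      using min[of "x + t *\<^sub>R w"] by simp
    moreover have "0 < w \<bullet> w" using False by simp
    ultimately have "c\<^sup>2 \<le> 0"
      by (meson divide_pos_pos linorder_not_less)
    then show ?thesis by (simp add: c_def)
  qed simp
  then show thesis by (rule that)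
qed

lemma surj_riesz: "surj (riesz :: 'h::{real_inner, complete_space} \<Rightarrow> 'h \<Rightarrow>\<^sub>L real)"
proof -
  have "\<exists>x. F = riesz x" for F :: "'h \<Rightarrow>\<^sub>L real"
  proof -
    obtain x where "\<And>w. blinfun_apply F w = x \<bullet> w"
      by (rule riesz_representation[OF blinfun.bounded_linear_right]) blast
    then have "F = riesz x" by (intro blinfun_eqI) simp
    then show ?thesis ..
  qed
  then show ?thesis by (auto simp: surj_def)
qed

lemma inv_riesz_inner [simp]:
  fixes F :: "'h::{real_inner, complete_space} \<Rightarrow>\<^sub>L real"
  shows "inv riesz F \<bullet> w = blinfun_apply F w"
  using surj_f_inv_f[OF surj_riesz, of F] riesz_apply[of "inv riesz F" w] by simp

lemma inv_riesz_eqI: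
  fixes F :: "'h::{real_inner, complete_space} \<Rightarrow>\<^sub>L real"
  assumes "\<And>w. blinfun_apply F w = x \<bullet> w"
  shows "inv riesz F = x"
  using assms by (intro vector_eq_rdot[THEN iffD1]) simp

lemma norm_inv_riesz:
  fixes F :: "'h::{real_inner, complete_space} \<Rightarrow>\<^sub>L real"
  shows "norm (inv riesz F) = norm F"
proof (rule antisym)
  let ?x = "inv riesz F"
  have "norm ?x * norm ?x = blinfun_apply F ?x"
    using inv_riesz_inner[of F ?x] by (simp flip: power2_norm_eq_inner power2_eq_square)
  also have "\<dots> \<le> norm F * norm ?x"
    using norm_blinfun[of F ?x] by simp
  finally show "norm ?x \<le> norm F"
    by (cases "?x = 0") auto
  show "norm F \<le> norm ?x"
    by (rule norm_blinfun_bound)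
      (auto simp flip: inv_riesz_inner intro: Cauchy_Schwarz_ineq2)
qed

section \<open>Best approximation in weakly closed sets\<close>

text \<open>
  Reduces weak closedness to the topology of pointwise convergence of functionals, for which
  Tychonoff's theorem is available. By the Riesz theorem the functionals \<open>v \<mapsto> v \<bullet> w\<close> exhaust the dual,
  and preimages of open sets under the embedding commute with unions and intersections.
\<close>
lemma openin_weak_topology_inner:
  fixes T :: "'h::{real_inner, complete_space} set"
  assumes "openin weak_topology T"
  obtains U where "open U" "T = (\<lambda>v w. v \<bullet> w) -` U"
proof -
  have "generate_topology_on {blinfun_apply f -` V |(f :: 'h \<Rightarrow>\<^sub>L real) V. open V} T"
    using assms by (simp add: weak_topology_def openin_topology_generated_by_iff)
  then have "\<exists>U. open U \<and> T = (\<lambda>v w. v \<bullet> w) -` U"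
  proof induction
    case Empty
    then show ?case by (intro exI[of _ "{}"]) auto
  next
    case (Int S T)
    then obtain U V where "open U" "S = (\<lambda>v w. v \<bullet> w) -` U" "open V" "T = (\<lambda>v w. v \<bullet> w) -` V"
      by blast
    then show ?case by (intro exI[of _ "U \<inter> V"]) auto
  next
    case (UN K)
    then obtain U where "\<And>k. k \<in> K \<Longrightarrow> open (U k) \<and> k = (\<lambda>v w. v \<bullet> w) -` U k"
      by metis
    then show ?case by (intro exI[of _ "\<Union>(U ` K)"]) blast
  next
    case (Basis s)
    then obtain f :: "'h \<Rightarrow>\<^sub>L real" and V where s: "s = blinfun_apply f -` V" and "open V"
      by blast
    have "blinfun_apply f v = v \<bullet> inv riesz f" for v
      using inv_riesz_inner[of f v] by (simp add: inner_commute)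
    then have "s = (\<lambda>v w. v \<bullet> w) -` ((\<lambda>g. g (inv riesz f)) -` V)"
      by (auto simp: s)
    moreover have "open ((\<lambda>g :: 'h \<Rightarrow> real. g (inv riesz f)) -` V)"
      by (intro open_vimage \<open>open V\<close>) (rule continuous_on_product_coordinates)
    ultimately show ?case by blast
  qed
  with that show thesis by blast
qed

text \<open>
  Weak compactness of bounded sequences, with a filter \<open>G\<close> finer than \<open>sequentially\<close> in place of
  a subsequence: Tychonoff's theorem applies in nonseparable spaces too, and provides a cluster point
  of the induced functionals in a product of compact intervals.
\<close>
lemma bounded_inner_cluster_point:
  fixes z :: "nat \<Rightarrow> 'h::{real_inner, complete_space}"
  assumes bound: "\<And>n. norm (z n) \<le> M"
  obtains G x where "G \<noteq> bot" "G \<le> sequentially" "\<And>w. ((\<lambda>n. z n \<bullet> w) \<longlongrightarrow> x \<bullet> w) G"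
    "((\<lambda>n w. z n \<bullet> w) \<longlongrightarrow> (\<lambda>w. x \<bullet> w)) G"
proof -
  define \<Phi> where "\<Phi> n w = z n \<bullet> w" for n w
  define K where "K = PiE UNIV (\<lambda>w :: 'h. {- (M * norm w) .. M * norm w})"
  have bound': "\<bar>z n \<bullet> w\<bar> \<le> M * norm w" for n w
    using Cauchy_Schwarz_ineq2[of "z n" w] mult_right_mono[OF bound[of n] norm_ge_zero[of w]]
    by linarith
  have "compactin (product_topology (\<lambda>_. euclidean) UNIV) K"
    unfolding K_def compactin_PiE by (auto simp: compactin_euclidean_iff)
  then have "compact K"
    by (simp add: euclidean_product_topology compactin_euclidean_iff)
  have "\<Phi> n \<in> K" for n
    using bound'[of n] by (auto simp: K_def \<Phi>_def abs_le_iff) (smt (verit))+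
  then have "eventually (\<lambda>g. g \<in> K) (filtermap \<Phi> sequentially)"
    by (simp add: eventually_filtermap)
  moreover have "filtermap \<Phi> sequentially \<noteq> bot"
    by (simp add: filtermap_bot_iff)
  ultimately obtain f where f: "inf (nhds f) (filtermap \<Phi> sequentially) \<noteq> bot"
    using \<open>compact K\<close> unfolding compact_filter by blast
  define G where "G = inf sequentially (filtercomap \<Phi> (nhds f))"
  have "G \<noteq> bot"
  proof
    assume "G = bot"
    then obtain P Q where P: "eventually P sequentially"
      and Q: "eventually Q (filtercomap \<Phi> (nhds f))" and PQ: "\<And>n. P n \<Longrightarrow> \<not> Q n"
      unfolding G_def trivial_limit_def eventually_inf by auto
    obtain R where R: "eventually R (nhds f)" "\<And>n. R (\<Phi> n) \<Longrightarrow> Q n"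
      using Q by (auto simp: eventually_filtercomap)
    have "eventually (\<lambda>g. \<not> R g) (filtermap \<Phi> sequentially)"
      unfolding eventually_filtermap using P by eventually_elim (use PQ R(2) in blast)
    then have "eventually (\<lambda>_. False) (inf (nhds f) (filtermap \<Phi> sequentially))"
      unfolding eventually_inf using R(1) by blast
    with f show False by (simp add: trivial_limit_def)
  qed
  have "G \<le> sequentially" by (simp add: G_def)
  have lim: "(\<Phi> \<longlongrightarrow> f) G"
    by (simp add: G_def filterlim_iff_le_filtercomap)
  have lim_at: "((\<lambda>n. z n \<bullet> w) \<longlongrightarrow> f w) G" for w
    using continuous_on_tendsto_compose[OF continuous_on_product_coordinates[of w] lim]
    by (simp add: \<Phi>_def)
  have "bounded_linear f"
  proof
    show "f (v + w) = f v + f w" for v w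
      using tendsto_unique[OF \<open>G \<noteq> bot\<close> lim_at[of "v + w"]] tendsto_add[OF lim_at[of v] lim_at[of w]]
      by (simp add: inner_add)
    show "f (r *\<^sub>R v) = r *\<^sub>R f v" for r v
      using tendsto_unique[OF \<open>G \<noteq> bot\<close> lim_at[of "r *\<^sub>R v"]] tendsto_mult_left[OF lim_at[of v], of r]
      by simp
    show "\<exists>M. \<forall>v. norm (f v) \<le> norm v * M"
    proof (intro exI allI)
      fix v
      show "norm (f v) \<le> norm v * M"
        by (rule tendsto_upperbound[OF tendsto_norm[OF lim_at[of v]] _ \<open>G \<noteq> bot\<close>])
          (use bound'[of _ v] in \<open>simp add: mult.commute\<close>)
    qed
  qed
  then obtain x where x: "\<And>w. f w = x \<bullet> w"
    using riesz_representation by blast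
  then have f_eq: "f = (\<lambda>w. x \<bullet> w)" by blast
  show thesis
    using \<open>G \<noteq> bot\<close> \<open>G \<le> sequentially\<close> lim_at[unfolded f_eq]
      lim[unfolded f_eq \<Phi>_def[abs_def]]
    by (rule that)
qed

text \<open>
  The weak cluster point of a minimizing sequence lies in \<open>S\<close> because \<open>S\<close> is weakly closed, and it
  realizes the infimum because the norm is weakly lower semicontinuous.
\<close>
lemma best_approx_nonempty:
  fixes S :: "'h::{real_inner, complete_space} set"
  assumes closed: "closedin weak_topology S" and "S \<noteq> {}"
  shows "best_approx S v \<noteq> {}"
proof -
  define d where "d = infdist v S"
  have d_le: "d \<le> norm (v - z)" if "z \<in> S" for z
    using infdist_le[OF that, of v] by (simp add: d_def dist_norm)
  have "\<exists>z\<in>S. norm (v - z) < d + inverse (real (Suc n))" for n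
  proof -
    have "(INF z\<in>S. dist v z) < d + inverse (real (Suc n))"
      using \<open>S \<noteq> {}\<close> by (simp add: d_def infdist_notempty)
    moreover have "bdd_below (dist v ` S)"
      by (rule bdd_belowI2[of _ 0]) simp
    ultimately show ?thesis
      using \<open>S \<noteq> {}\<close> by (simp add: cINF_less_iff dist_norm)
  qed
  then obtain z where zS: "\<And>n. z n \<in> S"
    and z: "\<And>n. norm (v - z n) < d + inverse (real (Suc n))"
    by metis
  have z_bound: "norm (z n) \<le> norm v + (d + 1)" for n
  proof -
    have "inverse (real (Suc n)) \<le> 1"
      by (simp add: inverse_le_1_iff)
    moreover have "norm (z n) \<le> norm v + norm (v - z n)"
      using norm_triangle_ineq4[of v "v - z n"] by simp
    ultimately show ?thesis
      using z[of n] by linarith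
  qed
  obtain G x where "G \<noteq> bot" "G \<le> sequentially"
    and lim_at: "\<And>w. ((\<lambda>n. z n \<bullet> w) \<longlongrightarrow> x \<bullet> w) G"
    and lim: "((\<lambda>n w. z n \<bullet> w) \<longlongrightarrow> (\<lambda>w. x \<bullet> w)) G"
    by (rule bounded_inner_cluster_point[OF z_bound]) (rule that)
  have "x \<in> S"
  proof (rule ccontr)
    assume "x \<notin> S"
    have "topspace (weak_topology :: 'h topology) = UNIV"
      unfolding weak_topology_def topology_generated_by_topspace by auto
    then have "openin weak_topology (- S)"
      using closed by (simp add: closedin_def Compl_eq_Diff_UNIV)
    then obtain U where "open U" and U: "- S = (\<lambda>v w. v \<bullet> w) -` U"
      by (rule openin_weak_topology_inner)
    have "(\<lambda>w. x \<bullet> w) \<in> U"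
      using U \<open>x \<notin> S\<close> by blast
    with lim \<open>open U\<close> have "eventually (\<lambda>n. (\<lambda>w. z n \<bullet> w) \<in> U) G"
      by (rule topological_tendstoD)
    then have "eventually (\<lambda>n. False) G"
      by eventually_elim (use U zS in blast)
    with \<open>G \<noteq> bot\<close> show False by (simp add: trivial_limit_def)
  qed
  moreover have "norm (v - x) \<le> d"
  proof -
    let ?w = "v - x"
    have "((\<lambda>n. v \<bullet> ?w - z n \<bullet> ?w) \<longlongrightarrow> v \<bullet> ?w - x \<bullet> ?w) G"
      by (intro tendsto_intros lim_at)
    moreover have "(\<lambda>n. (d + inverse (real (Suc n))) * norm ?w) \<longlonglongrightarrow> (d + 0) * norm ?w"
      by (intro tendsto_intros LIMSEQ_inverse_real_of_nat)
    then have "((\<lambda>n. (d + inverse (real (Suc n))) * norm ?w) \<longlongrightarrow> (d + 0) * norm ?w) G"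
      by (rule tendsto_mono[OF \<open>G \<le> sequentially\<close>])
    moreover have "v \<bullet> ?w - z n \<bullet> ?w \<le> (d + inverse (real (Suc n))) * norm ?w" for n
    proof -
      have "v \<bullet> ?w - z n \<bullet> ?w \<le> norm (v - z n) * norm ?w"
        using norm_cauchy_schwarz[of "v - z n" ?w] by (simp add: inner_diff_left)
      also have "\<dots> \<le> (d + inverse (real (Suc n))) * norm ?w"
        using z[of n] by (intro mult_right_mono) auto
      finally show ?thesis .
    qed
    ultimately have "v \<bullet> ?w - x \<bullet> ?w \<le> (d + 0) * norm ?w"
      using \<open>G \<noteq> bot\<close> by (intro tendsto_le[of G]) auto
    then have "norm ?w * norm ?w \<le> d * norm ?w"
      by (simp flip: inner_diff_left power2_norm_eq_inner power2_eq_square)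
    moreover have "0 \<le> d" by (simp add: d_def infdist_nonneg)
    ultimately show ?thesis
      by (cases "?w = 0") auto
  qed
  ultimately have "x \<in> best_approx S v"
    using d_le by (force simp: best_approx_def is_arg_min_linorder)
  then show ?thesis by blast
qed

lemma best_error_obtains:
  fixes S :: "'h::{real_inner, complete_space} set"
  assumes "closedin weak_topology S" "S \<noteq> {}"
  obtains z where "z \<in> S" "best_error S v = norm (v - z)"
    "\<And>s. s \<in> S \<Longrightarrow> best_error S v \<le> norm (v - s)"
proof -
  obtain z where z: "z \<in> best_approx S v"
    using best_approx_nonempty[OF assms] by blast
  then have "z \<in> S" "\<And>s. s \<in> S \<Longrightarrow> norm (v - z) \<le> norm (v - s)"
    by (auto simp: best_approx_def is_arg_min_linorder)
  with that best_error_eq[OF z] show thesis by simp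
qed

lemma best_error_nonneg:
  fixes S :: "'h::{real_inner, complete_space} set"
  assumes "closedin weak_topology S" "S \<noteq> {}"
  shows "0 \<le> best_error S v"
  by (rule best_error_obtains[OF assms, of v]) simp

lemma best_error_Lipschitz:
  fixes S :: "'h::{real_inner, complete_space} set"
  assumes "closedin weak_topology S" "S \<noteq> {}"
  shows "best_error S v \<le> norm (v - u) + best_error S u"
proof -
  obtain z where z: "z \<in> S" "best_error S u = norm (u - z)"
    using best_error_obtains[OF assms] by metis
  then have "best_error S v \<le> norm (v - z)"
    using best_error_obtains[OF assms, of v] by metis
  also have "\<dots> \<le> norm (v - u) + norm (u - z)"
    using norm_triangle_ineq[of "v - u" "u - z"] by simp
  finally show ?thesis using z by simp
qed

section \<open>The perturbed gradient iteration\<close>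

lemma linear_isometry_inner:
  fixes T :: "'x::real_inner \<Rightarrow> 'y::real_inner"
  assumes "linear T" "\<And>v. norm (T v) = norm v"
  shows "T v \<bullet> T w = v \<bullet> w"
  using assms(2)[of v] assms(2)[of w] assms(2)[of "v + w"]
  by (simp add: dot_norm linear_add[OF assms(1)])

text \<open>
  The adjoint \<open>T'\<close> of an isometry \<open>T\<close> is a left inverse of norm at most one, so replacing the exact
  residual \<open>T e\<close> by \<open>y\<close> perturbs the result by at most the error in \<open>y\<close>.
\<close>
lemma isometry_adjoint_error:
  fixes T :: "'x::real_inner \<Rightarrow> 'y::real_inner"
  assumes "linear T" and iso: "\<And>v. norm (T v) = norm v"
    and adj: "\<And>v. x \<bullet> v = T v \<bullet> y"
  shows "norm (e - x) \<le> norm (y - T e)"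
proof -
  let ?r = "x - e"
  have "?r \<bullet> v = T v \<bullet> (y - T e)" for v
    using linear_isometry_inner[OF \<open>linear T\<close> iso, of v e] adj[of v]
    by (simp add: inner_diff inner_commute)
  from this[of ?r] have "norm ?r * norm ?r = T ?r \<bullet> (y - T e)"
    by (metis power2_norm_eq_inner power2_eq_square)
  also have "\<dots> \<le> norm ?r * norm (y - T e)"
    using norm_cauchy_schwarz[of "T ?r" "y - T e"] by (simp add: iso)
  finally have "norm ?r \<le> norm (y - T e)"
    by (cases "?r = 0") auto
  then show ?thesis by (simp add: norm_minus_commute)
qed

text \<open>
  The constant \<open>c / (1 - q)\<close> is the fixed point of \<open>t \<mapsto> q t + c\<close>.
\<close>
lemma affine_recursion_bound:
  fixes e :: "nat \<Rightarrow> real"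
  assumes "0 \<le> q" "q < 1" "0 \<le> c" and step: "\<And>k. e (Suc k) \<le> q * e k + c"
  shows "e k \<le> q ^ k * e 0 + c / (1 - q)"
proof (induction k)
  case 0
  show ?case using assms by simp
next
  case (Suc k)
  have "e (Suc k) \<le> q * (q ^ k * e 0 + c / (1 - q)) + c"
    using step[of k] mult_left_mono[OF Suc \<open>0 \<le> q\<close>] by linarith
  also have "\<dots> = q ^ Suc k * e 0 + c / (1 - q)"
    using \<open>q < 1\<close> by (simp add: field_simps)
  finally show ?case .
qed

theorem proposition4p3:
  fixes a :: "'x::{real_inner, complete_space} \<Rightarrow> 'y::{real_inner, complete_space} \<Rightarrow> real"
    and A :: "'x \<Rightarrow> 'y \<Rightarrow>\<^sub>L real"
    and Astar :: "'y \<Rightarrow> 'x \<Rightarrow>\<^sub>L real"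
    and b :: "'y \<Rightarrow>\<^sub>L real"
    and u :: 'x
    and S :: "'x set"
    and \<delta> \<eta> :: real
    and \<Lambda> :: "'y \<Rightarrow> 'y"
    and P :: "'x \<Rightarrow> 'x set"
    and useq :: "nat \<Rightarrow> 'x"
    and yseq :: "nat \<Rightarrow> 'y"
  assumes form: "weakly_coercive_form a"
    and op: "\<And>v w. blinfun_apply (A v) w = a v w"
    and adj: "\<And>v w. blinfun_apply (Astar w) v = blinfun_apply (A v) w"
    and sol: "A u = b"
    and S_nonempty: "S \<noteq> {}"
    and S_weakly_closed: "closedin weak_topology S"
    and S_cone: "\<And>\<gamma>::real. (\<lambda>z. \<gamma> *\<^sub>R z) ` S \<subseteq> S"
    and isometry: "\<And>v. norm (A v) = norm v"
    and \<delta>: "\<delta> > 0"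
    and \<eta>: "\<eta> \<ge> 1"
    and \<delta>\<eta>: "\<delta> * (1 + \<eta>) < 1"
    and \<Lambda>: "\<And>y. y \<in> {inv riesz (A v - b) |v. v \<in> S} \<Longrightarrow> norm (\<Lambda> y - y) \<le> \<delta> * norm y"
    and P_nonempty: "\<And>v. P v \<noteq> {}"
    and P_subset: "\<And>v. P v \<subseteq> S"
    and P_quasi_opt: "\<And>v w. w \<in> P v \<Longrightarrow> norm (v - w) \<le> \<eta> * best_error S v"
    and u0: "useq 0 = 0"
    and useq_in: "\<And>k. useq k \<in> S"
    and y_step: "\<And>k. yseq k = \<Lambda> (inv riesz (A (useq k) - b))"
    and u_step: "\<And>k. useq (Suc k) \<in> P (useq k - inv riesz (Astar (yseq k)))"
  shows "\<forall>k\<ge>1. norm (useq k - u)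
           \<le> ((1 + \<eta>) * \<delta>) ^ k * norm (useq 0 - u)
             + \<eta> / (1 - \<delta> * (1 + \<eta>)) * best_error S u"
proof -
  define T where "T v = inv riesz (A v)" for v
  have bil: "bilinear a"
    using form by (simp add: weakly_coercive_form_def)
  have A_add: "A (v + w) = A v + A w" and A_scale: "A (r *\<^sub>R v) = r *\<^sub>R A v" for v w r
    by (intro blinfun_eqI; simp add: op plus_blinfun.rep_eq scaleR_blinfun.rep_eq
        bilinear_ladd[OF bil] bilinear_lmul[OF bil])+
  have T_inner: "T v \<bullet> w = blinfun_apply (A v) w" for v w
    by (simp add: T_def)
  have "linear T"
  proof
    show "T (v + w) = T v + T w" for v w
      unfolding T_def[of "v + w"]
      by (rule inv_riesz_eqI) (simp add: A_add inner_add T_inner plus_blinfun.rep_eq)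
    show "T (r *\<^sub>R v) = r *\<^sub>R T v" for r v
      unfolding T_def[of "r *\<^sub>R v"]
      by (rule inv_riesz_eqI) (simp add: A_scale T_inner scaleR_blinfun.rep_eq)
  qed
  have T_iso: "norm (T v) = norm v" for v
    by (simp add: T_def norm_inv_riesz isometry)
  have residual: "inv riesz (A v - b) = T (v - u)" for v
    by (rule inv_riesz_eqI)
      (simp add: linear_diff[OF \<open>linear T\<close>] inner_diff T_inner minus_blinfun.rep_eq flip: sol)
  note S = S_weakly_closed S_nonempty
  have step: "norm (useq (Suc k) - u)
      \<le> (1 + \<eta>) * \<delta> * norm (useq k - u) + \<eta> * best_error S u" for k
  proof -
    define x where "x = inv riesz (Astar (yseq k))"
    let ?v = "useq k - x" and ?e = "norm (useq k - u)"
    have "x \<bullet> v = T v \<bullet> yseq k" for v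
      by (simp add: x_def T_inner adj)
    then have "norm (?v - u) \<le> norm (yseq k - T (useq k - u))"
      using isometry_adjoint_error[OF \<open>linear T\<close> T_iso, of x "yseq k" "useq k - u"]
      by (simp add: algebra_simps)
    also have "\<dots> \<le> \<delta> * ?e"
      using \<Lambda>[of "inv riesz (A (useq k) - b)"] useq_in[of k]
      by (auto simp: y_step residual T_iso)
    finally have v: "norm (?v - u) \<le> \<delta> * ?e" .
    have "norm (?v - useq (Suc k)) \<le> \<eta> * best_error S ?v"
      using P_quasi_opt u_step[of k] by (simp add: x_def)
    also have "\<dots> \<le> \<eta> * (\<delta> * ?e + best_error S u)"
      using best_error_Lipschitz[OF S, of ?v u] v \<eta> by (intro mult_left_mono) auto
    finally have "norm (?v - useq (Suc k)) \<le> \<eta> * (\<delta> * ?e + best_error S u)" .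
    moreover have "norm (useq (Suc k) - u) \<le> norm (?v - u) + norm (?v - useq (Suc k))"
      using norm_triangle_ineq4[of "?v - u" "?v - useq (Suc k)"] by simp
    ultimately show ?thesis
      using v by (simp add: algebra_simps)
  qed
  have "norm (useq k - u) \<le> ((1 + \<eta>) * \<delta>) ^ k * norm (useq 0 - u)
      + (\<eta> * best_error S u) / (1 - (1 + \<eta>) * \<delta>)" for k
    using \<delta> \<eta> \<delta>\<eta> best_error_nonneg[OF S, of u] step
    by (intro affine_recursion_bound) (auto simp: mult.commute)
  then show ?thesis
    by (simp add: mult.commute)
qed

end
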